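(* Let $m,q\geq 2$. Let $\lambda$ be a conjugate $(m,q)$-ary partition generated by $M^{s_k}R^{t_k}\cdots M^{s_1}R^{t_1}(1)_m$, where $s_{k}, t_1 \geq 0$ but all other exponents are strictly positive. Suppose that $k=2b+1$ is odd. Then $$\chi(M^{s_{2b+1}}R^{t_{2b+1}}\cdots M^{s_1}R^{t_1}) = \sum_{i=1}^{b} \left( m^{s_1+\cdots+s_{2b+1-i}}q^{t_{2b+3-i}+\cdots+ t_{2b+1}}(m^{s_{2b+2-i}} -1) \right)$$ $$ + m^{s_1+\cdots+s_{b+1}}q^{t_{b+2}+\cdots+t_{2b+1}} - m^{s_1+\cdots+s_{b}}q^{t_{b+2}+\cdots+t_{2b+1}} + m^{s_1+\cdots+s_{b}}q^{t_{b+1}+\cdots+t_{2b+1}}$$ $$ + \sum_{i=1}^{b} \left( m^{s_1+\cdots+s_{i-1}}q^{t_{i+1}+\cdots+ t_{2b+1}}(q^{t_i} -1) \right).$$ Suppose that $k=2b$ is even. Then $$\chi(M^{s_{2b}}R^{t_{2b}}\cdots M^{s_1}R^{t_1}) = \sum_{i=1}^{b} \left( m^{s_1+\cdots+s_{2b-i}}q^{t_{2b+2-i}+\cdots+ t_{2b}}(m^{s_{2b+1-i}} -1) \right)$$ $$ + m^{s_1+\cdots+s_{b}}q^{t_{b+1}+\cdots+t_{2b}} + \sum_{i=1}^{b} \left( m^{s_1+\cdots+s_{i-1}}q^{t_{i+1}+\cdots+ t_{2b}}(q^{t_i} -1) \right).$$ In each case, if $\lambda$ is simple so that all exponents $s_i,t_i$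 are strictly positive, then (in the fully expanded polynomial) there are $k+1$ distinct monomials with coefficient $+1$ and $k$ distinct monomials with coefficient $-1$.
   Context: Let $m,q\ge 2$ be integers. A partition $\lambda$ of a positive integer $n$ is $m$-ary if all its parts are powers $m^i$, $i\ge 0$ (so $m^0=1$ is allowed). If $a_i$ is the number of times the part $m^i$ appears in $\lambda$, one writes $\lambda=(a_k,a_{k-1},\ldots,a_0)_m$, where $a_k\neq 0$ and $a_i=0$ for $i>k$. $\lambda$ is conjugate $(m,q)$-ary if $\lambda$ is $m$-ary and its conjugate $\lambda'$ is $q$-ary; equivalently, $\lambda$ is $m$-ary and each partial sum $\sum_{i=r}^k a_i$, $0\le r\le k$, is a power of $q$ (with $q^0=1$ allowed). For a conjugate $(m,q)$-ary partition $\lambda=(a_k,\ldots,a_0)_m$, define the operators (each producing a conjugate $(m,q)$-ary partition): raise $R(\lambda)=(qa_k,\ldots,qa_0)_m$; migration $M(\lambda)=(1,a_k-1,a_{k-1},\ldots,a_0)_m$; shift $S(\lambda)=(a_k,\ldots,a_0,0)_m$. Sequences of operators are composed as functions (rightmost applied first). A conjugate $(m,q)$-ary partition is simple if it is neither a raise nor a shift of another such partition. Characteristic polynomial: let $A$ be a sequence of $R$ and $M$ operators, and write $A(1)_m=(a_K,\ldots,a_0)_m$, where $(1)_m$ is the trivial partition of $1$. Then $a_K=q^{e_K}$ and $a_i=q^{e_i}-q^{e_{i+1}}$ for $0\le i<K$, for exponents $e_i$ depending only on the sequence $A$. Treating $m$ and $q$ as independent indeterminates, one sets $$\chi(A)=q^{e_K}m^K+\sum_{i=0}^{K-1}(q^{e_i}-q^{e_{i+1}})m^i\in\mathbb{Z}[m,q].$$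 Empty sums (including empty sums in exponents) are $0$.
   Formalization: That a simple λ has all exponents s_i, t_i strictly positive is claimed only for λ ≠ (1)_m: the trivial partition is simple but arises from k=1, s_1=t_1=0, where χ=1 and the counts k+1 and k fail. *)

theory Defs
  imports Main "HOL-Library.Multiset" "HOL-Library.Poly_Mapping" "HOL-Library.Product_Plus"
begin

section \<open>Conjugate $(m,q)$-ary partitions\<close>

text \<open>A partition is the multiset of its parts.\<close>

definition is_partition :: "nat multiset \<Rightarrow> nat \<Rightarrow> bool" where
  "is_partition lam n \<longleftrightarrow> 0 \<notin># lam \<and> sum_mset lam = n"

text \<open>The \<open>j\<close>-th part of the conjugate partition is the number of parts that are at least \<open>j\<close>
  (the length of the \<open>j\<close>-th column of the Young diagram).\<close>

definition conjugate :: "nat multiset \<Rightarrow> nat multiset" where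
  "conjugate lam =
     image_mset (\<lambda>j. size (filter_mset (\<lambda>x. j \<le> x) lam)) (mset_set {1..Max (set_mset lam)})"

definition m_ary :: "nat \<Rightarrow> nat multiset \<Rightarrow> bool" where
  "m_ary m lam \<longleftrightarrow> (\<exists>n>0. is_partition lam n) \<and> (\<forall>x\<in>#lam. \<exists>i. x = m ^ i)"

definition conj_ary :: "nat \<Rightarrow> nat \<Rightarrow> nat multiset \<Rightarrow> bool" where
  "conj_ary m q lam \<longleftrightarrow> m_ary m lam \<and> m_ary q (conjugate lam)"

text \<open>The notation $(a_k,\dots,a_0)_m$: \<open>of_mults\<close> turns the list $[a_k,\dots,a_0]$ into a
  partition, and \<open>mults\<close> reads off the list (with leading entry $a_k \neq 0$) from a partition.\<close>

primrec of_mults :: "nat \<Rightarrow> nat list \<Rightarrow> nat multiset" where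
  "of_mults m [] = {#}"
| "of_mults m (a # as) = replicate_mset a (m ^ length as) + of_mults m as"

definition top_exp :: "nat \<Rightarrow> nat multiset \<Rightarrow> nat" where
  "top_exp m lam = Max {i. m ^ i \<in># lam}"

definition mults :: "nat \<Rightarrow> nat multiset \<Rightarrow> nat list" where
  "mults m lam = map (\<lambda>i. count lam (m ^ i)) (rev [0..<Suc (top_exp m lam)])"


section \<open>Operators\<close>

definition raise_part :: "nat \<Rightarrow> nat \<Rightarrow> nat multiset \<Rightarrow> nat multiset" where
  "raise_part m q lam = of_mults m (map (\<lambda>a. q * a) (mults m lam))"

definition migrate_part :: "nat \<Rightarrow> nat multiset \<Rightarrow> nat multiset" where
  "migrate_part m lam = of_mults m (1 # (hd (mults m lam) - 1) # tl (mults m lam))"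

definition shift_part :: "nat \<Rightarrow> nat multiset \<Rightarrow> nat multiset" where
  "shift_part m lam = of_mults m (mults m lam @ [0])"

definition simple_part :: "nat \<Rightarrow> nat \<Rightarrow> nat multiset \<Rightarrow> bool" where
  "simple_part m q lam \<longleftrightarrow> conj_ary m q lam \<and>
     \<not> (\<exists>mu. conj_ary m q mu \<and> mu \<noteq> lam \<and> (lam = raise_part m q mu \<or> lam = shift_part m mu))"

datatype operator = Raise | Migrate

primrec apply_operator :: "nat \<Rightarrow> nat \<Rightarrow> operator \<Rightarrow> nat multiset \<Rightarrow> nat multiset" where
  "apply_operator m q Raise = raise_part m q"
| "apply_operator m q Migrate = migrate_part m"

text \<open>The head of the list is the leftmost operator, which is applied last.\<close>

definition apply_seq :: "nat \<Rightarrow> nat \<Rightarrow> operator list \<Rightarrow> nat multiset \<Rightarrow> nat multiset" where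
  "apply_seq m q A = foldr (apply_operator m q) A"

text \<open>The trivial partition $(1)_m$, of the number $1$.\<close>

abbreviation trivial_part :: "nat multiset" where
  "trivial_part \<equiv> {#1#}"

text \<open>\<open>op_seq s t k\<close> is $M^{s_k} R^{t_k} \cdots M^{s_1} R^{t_1}$; only the values of \<open>s\<close> and \<open>t\<close>
  at $1,\dots,k$ matter.\<close>

primrec op_seq :: "(nat \<Rightarrow> nat) \<Rightarrow> (nat \<Rightarrow> nat) \<Rightarrow> nat \<Rightarrow> operator list" where
  "op_seq s t 0 = []"
| "op_seq s t (Suc k) =
     replicate (s (Suc k)) Migrate @ replicate (t (Suc k)) Raise @ op_seq s t k"


section \<open>The characteristic polynomial\<close>

text \<open>The list \<open>es\<close> is $[e_0,\dots,e_K]$. The same list has to work for all $m, q \ge 2$, so that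
  it depends on the operator sequence only.\<close>

definition is_exponents :: "operator list \<Rightarrow> nat list \<Rightarrow> bool" where
  "is_exponents A es \<longleftrightarrow> (\<forall>m\<ge>2. \<forall>q\<ge>2.
     let lam = apply_seq m q A trivial_part;
         K = top_exp m lam;
         a = (\<lambda>i. int (count lam (m ^ i)))
     in length es = Suc K \<and> a K = int q ^ (es ! K) \<and>
        (\<forall>i<K. a i = int q ^ (es ! i) - int q ^ (es ! Suc i)))"

definition exponents :: "operator list \<Rightarrow> nat list" where
  "exponents A = (THE es. is_exponents A es)"

text \<open>$\mathbb{Z}[m,q]$ as the integral monoid ring of $\mathbb{N}\times\mathbb{N}$: the pair
  \<open>(i, j)\<close> stands for the monomial $m^i q^j$, whose coefficient in \<open>p\<close> is
  \<open>Poly_Mapping.lookup p (i, j)\<close>.\<close>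

type_synonym zpoly2 = "(nat \<times> nat) \<Rightarrow>\<^sub>0 int"

definition var_m :: zpoly2 where
  "var_m = Poly_Mapping.single (1, 0) 1"

definition var_q :: zpoly2 where
  "var_q = Poly_Mapping.single (0, 1) 1"

definition chi :: "operator list \<Rightarrow> zpoly2" where
  "chi A = (let es = exponents A; K = length es - 1 in
     var_q ^ (es ! K) * var_m ^ K
     + (\<Sum>i<K. (var_q ^ (es ! i) - var_q ^ (es ! Suc i)) * var_m ^ i))"


section \<open>Well-definedness\<close>

lemma filter_replicate_mset:
  "filter_mset P (replicate_mset n x) = (if P x then replicate_mset n x else {#})"
  by (induction n) auto

lemma count_of_mults:
  assumes "m \<ge> 2"
  shows "count (of_mults m as) (m ^ i) = (if i < length as then rev as ! i else 0)"
  using assms by (induction as) (auto simp: nth_append power_inject_exp)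

lemma top_exp_of_mults:
  assumes "m \<ge> 2" "a > 0"
  shows "top_exp m (of_mults m (a # as)) = length as"
proof -
  have iff: "m ^ i \<in># of_mults m (a # as) \<longleftrightarrow> count (of_mults m (a # as)) (m ^ i) > 0" for i
    by simp
  have "length as \<in> {i. m ^ i \<in># of_mults m (a # as)}"
    using assms by simp
  moreover have "{i. m ^ i \<in># of_mults m (a # as)} \<subseteq> {..length as}"
    unfolding iff count_of_mults[OF assms(1)] by (auto split: if_splits)
  ultimately show ?thesis
    unfolding top_exp_def
    by (intro Max_eqI) (blast intro: finite_subset[OF _ finite_atMost])+
qed

lemma mults_of_mults:
  assumes "m \<ge> 2" "a > 0"
  shows "mults m (of_mults m (a # as)) = a # as"
proof (rule nth_equalityI)
  show "length (mults m (of_mults m (a # as))) = length (a # as)"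
    unfolding mults_def top_exp_of_mults[OF assms] by simp
  fix i assume "i < length (mults m (of_mults m (a # as)))"
  hence i: "i < Suc (length as)"
    unfolding mults_def top_exp_of_mults[OF assms] by simp
  have "rev [0..<Suc (length as)] ! i = length as - i"
    using i by (simp add: rev_nth del: upt_Suc)
  hence "mults m (of_mults m (a # as)) ! i = count (of_mults m (a # as)) (m ^ (length as - i))"
    unfolding mults_def top_exp_of_mults[OF assms] using i
    by (subst nth_map) (simp_all del: upt_Suc of_mults.simps)
  also have "\<dots> = (a # as) ! i"
    unfolding count_of_mults[OF assms(1)] using i
    by (simp add: rev_nth less_Suc_eq_le del: rev.simps)
  finally show "mults m (of_mults m (a # as)) ! i = (a # as) ! i" .
qed

text \<open>The exponents computed recursively, here as $[e_K,\dots,e_0]$, and the resulting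
  multiplicities.\<close>

primrec exps_rec :: "operator list \<Rightarrow> nat list" where
  "exps_rec [] = [0]"
| "exps_rec (x # A) = (case x of Raise \<Rightarrow> map Suc (exps_rec A) | Migrate \<Rightarrow> 0 # exps_rec A)"

primrec diffs :: "nat \<Rightarrow> nat \<Rightarrow> nat list \<Rightarrow> nat list" where
  "diffs q p [] = []"
| "diffs q p (e # es) = (q ^ e - p) # diffs q (q ^ e) es"

lemma diffs_raise: "map (\<lambda>a. q * a) (diffs q p es) = diffs q (q * p) (map Suc es)"
  by (induction es arbitrary: p) (auto simp: diff_mult_distrib2)

lemma length_diffs [simp]: "length (diffs q p es) = length es"
  by (induction es arbitrary: p) auto

lemma exps_rec_nonempty: "exps_rec A \<noteq> []"
  by (induction A) (auto split: operator.splits)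

lemma sorted_exps_rec: "sorted (exps_rec A)"
  by (induction A) (auto split: operator.splits simp: sorted_map)

lemma apply_seq_trivial:
  assumes "m \<ge> 2" "q \<ge> 2"
  shows "apply_seq m q A trivial_part = of_mults m (diffs q 0 (exps_rec A))"
proof (induction A)
  case Nil
  show ?case by (simp add: apply_seq_def)
next
  case (Cons x A)
  obtain e es where e: "exps_rec A = e # es"
    using exps_rec_nonempty by (metis list.exhaust)
  have m: "mults m (apply_seq m q A trivial_part) = q ^ e # diffs q (q ^ e) es"
    unfolding Cons e using assms mults_of_mults[of m "q ^ e"] by (simp del: of_mults.simps)
  have *: "apply_seq m q (x # A) trivial_part
      = apply_operator m q x (apply_seq m q A trivial_part)"
    by (simp add: apply_seq_def)
  show ?case
  proof (cases x)
    case Raise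
    then show ?thesis
      unfolding * using e m diffs_raise[of q 0 "e # es"]
      by (simp add: raise_part_def del: of_mults.simps)
  next
    case Migrate
    then show ?thesis
      unfolding * using e m by (simp add: migrate_part_def del: of_mults.simps)
  qed
qed

lemma nth_diffs:
  "i < length es \<Longrightarrow> diffs q p es ! i = q ^ (es ! i) - (if i = 0 then p else q ^ (es ! (i - 1)))"
proof (induction es arbitrary: p i)
  case (Cons e es)
  then show ?case by (cases i) (auto simp: nth_Cons split: nat.splits)
qed simp

lemma is_exponents_exps_rec: "is_exponents A (rev (exps_rec A))"
  unfolding is_exponents_def
proof (intro allI impI)
  fix m q :: nat assume mq: "m \<ge> 2" "q \<ge> 2"
  define L where "L = exps_rec A"
  define lam where "lam = apply_seq m q A trivial_part"
  obtain e es where e: "L = e # es"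
    unfolding L_def using exps_rec_nonempty by (metis list.exhaust)
  have lam: "lam = of_mults m (diffs q 0 L)"
    unfolding lam_def L_def by (rule apply_seq_trivial[OF mq])
  have K: "top_exp m lam = length es"
    unfolding lam e using top_exp_of_mults[OF mq(1), of "q ^ e"] mq by (simp del: of_mults.simps)
  have cnt: "count lam (m ^ i) = diffs q 0 L ! (length es - i)" if "i \<le> length es" for i
    unfolding lam count_of_mults[OF mq(1)] using that by (simp add: e rev_nth del: diffs.simps)
  have top: "int (count lam (m ^ length es)) = int q ^ (rev L ! length es)"
    using cnt[of "length es"] by (simp add: e nth_append)
  have low: "int (count lam (m ^ i)) = int q ^ (rev L ! i) - int q ^ (rev L ! Suc i)"
    if i: "i < length es" for i
  proof -
    have "sorted L"
      unfolding L_def by (rule sorted_exps_rec)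
    hence "L ! (length es - i - 1) \<le> L ! (length es - i)"
      by (rule sorted_nth_mono) (auto simp: e)
    hence "q ^ (L ! (length es - i - 1)) \<le> q ^ (L ! (length es - i))"
      using mq by (simp add: power_increasing)
    moreover have "count lam (m ^ i) = q ^ (L ! (length es - i)) - q ^ (L ! (length es - i - 1))"
      using i cnt[of i] by (simp add: nth_diffs e del: diffs.simps)
    moreover have "rev L ! i = L ! (length es - i)" "rev L ! Suc i = L ! (length es - i - 1)"
      using i by (simp_all add: e rev_nth del: rev.simps)
    ultimately show ?thesis
      by (simp add: of_nat_diff)
  qed
  show "let lam = apply_seq m q A trivial_part; K = top_exp m lam;
            a = \<lambda>i. int (count lam (m ^ i))
        in length (rev (exps_rec A)) = Suc K \<and> a K = int q ^ (rev (exps_rec A) ! K) \<and>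
           (\<forall>i<K. a i = int q ^ (rev (exps_rec A) ! i) - int q ^ (rev (exps_rec A) ! Suc i))"
    unfolding Let_def L_def[symmetric] lam_def[symmetric] K using top low by (simp add: e)
qed

lemma is_exponents_unique:
  assumes "is_exponents A es" "is_exponents A es'"
  shows "es = es'"
proof -
  define lam where "lam = apply_seq 2 2 A trivial_part"
  define K where "K = top_exp 2 lam"
  define a where "a i = int (count lam (2 ^ i))" for i
  have *: "length es = Suc K \<and> a K = 2 ^ (es ! K) \<and>
        (\<forall>i<K. a i = 2 ^ (es ! i) - 2 ^ (es ! Suc i))"
    if "is_exponents A es" for es
    using that[unfolded is_exponents_def, rule_format, of 2 2]
    by (simp add: Let_def lam_def K_def a_def)
  note 1 = *[OF assms(1)] and 2 = *[OF assms(2)]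
  have "es ! i = es' ! i" if "i \<le> K" for i
    using that
  proof (induction rule: inc_induct)
    case base
    have "(2::int) ^ (es ! K) = 2 ^ (es' ! K)" using 1 2 by metis
    then show ?case by simp
  next
    case (step i)
    have "(2::int) ^ (es ! i) = 2 ^ (es' ! i)" using 1 2 step by (metis diff_eq_eq diff_add_cancel)
    then show ?case by simp
  qed
  then show ?thesis using 1 2 by (intro nth_equalityI) auto
qed

lemma ex1_exponents: "\<exists>!es. is_exponents A es"
  using is_exponents_exps_rec is_exponents_unique by blast

lemma exponents_eq: "exponents A = rev (exps_rec A)"
  unfolding exponents_def using is_exponents_exps_rec is_exponents_unique by blast

text \<open>Every operator sequence in \<open>Raise\<close> and \<open>Migrate\<close> generates a conjugate
  $(m,q)$-ary partition.\<close>

lemma of_mults_parts: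
  "x \<in># of_mults m as \<Longrightarrow> \<exists>i<length as. x = m ^ i"
proof (induction as)
  case (Cons a as)
  then show ?case
    by (auto simp: less_Suc_eq split: if_splits)
qed simp

lemma size_filter_diffs:
  assumes "m \<ge> 2" "q \<ge> 2" "sorted es" "es \<noteq> [] \<longrightarrow> p \<le> q ^ hd es"
  defines "f \<equiv> \<lambda>j p es. size (filter_mset (\<lambda>x. j \<le> x) (of_mults m (diffs q p es)))"
  shows "f j p es = 0 \<or> (\<exists>e. f j p es + p = q ^ e)"
  using assms(3,4)
proof (induction es arbitrary: p)
  case Nil
  then show ?case by (simp add: f_def)
next
  case (Cons e es)
  have hd: "es \<noteq> [] \<longrightarrow> q ^ e \<le> q ^ hd es"
    using Cons.prems assms(2) by (cases es) (auto intro: power_increasing)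
  have IH: "f j (q ^ e) es = 0 \<or> (\<exists>e'. f j (q ^ e) es + q ^ e = q ^ e')"
    using Cons.IH[of "q ^ e"] Cons.prems hd by auto
  show ?case
  proof (cases "j \<le> m ^ length es")
    case True
    hence "f j p (e # es) = (q ^ e - p) + f j (q ^ e) es"
      by (simp add: f_def filter_replicate_mset)
    moreover have "p \<le> q ^ e" using Cons.prems(2) by simp
    ultimately have sum: "f j p (e # es) + p = f j (q ^ e) es + q ^ e" by linarith
    show ?thesis
      unfolding sum using IH by auto
  next
    case False
    have "\<not> j \<le> x" if x: "x \<in># of_mults m (diffs q p (e # es))" for x
    proof -
      obtain i where "i < Suc (length es)" "x = m ^ i"
        using of_mults_parts[OF x] by auto
      hence "x \<le> m ^ length es"
        using assms(1) by (auto intro: power_increasing)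
      thus ?thesis using False by simp
    qed
    hence "f j p (e # es) = 0"
      unfolding f_def by (simp add: filter_mset_eq_mempty_iff del: of_mults.simps diffs.simps)
    thus ?thesis by simp
  qed
qed

lemma conj_ary_apply_seq:
  assumes "m \<ge> 2" "q \<ge> 2"
  shows "conj_ary m q (apply_seq m q A trivial_part)"
proof -
  define lam where "lam = of_mults m (diffs q 0 (exps_rec A))"
  obtain e es where e: "exps_rec A = e # es"
    using exps_rec_nonempty by (metis list.exhaust)
  have parts: "\<exists>i\<le>length es. x = m ^ i" if "x \<in># lam" for x
    using of_mults_parts[OF that[unfolded lam_def e]] by (auto simp: less_Suc_eq_le)
  have mem: "m ^ length es \<in># lam"
    using assms by (simp add: lam_def e)
  have Max: "Max (set_mset lam) = m ^ length es"
    using parts mem assms by (intro Max_eqI) (auto intro: power_increasing dest!: parts)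
  have pos: "0 \<notin># lam"
    using parts assms by fastforce
  have "sum_mset lam > 0"
    using mem pos by (metis bot_nat_0.not_eq_extremum sum_mset_0_iff)
  hence 1: "m_ary m lam"
    unfolding m_ary_def is_partition_def using pos parts by auto
  define c where "c j = size (filter_mset (\<lambda>x. j \<le> x) lam)" for j
  have c: "c j > 0 \<and> (\<exists>i. c j = q ^ i)" if "j \<le> m ^ length es" for j
  proof -
    have "c j \<noteq> 0"
      using mem that by (auto simp: c_def filter_mset_eq_mempty_iff)
    moreover have "c j = 0 \<or> (\<exists>i. c j + 0 = q ^ i)"
      unfolding c_def lam_def
      by (rule size_filter_diffs[OF assms sorted_exps_rec]) simp
    ultimately show ?thesis by auto
  qed
  have conj: "conjugate lam = image_mset c (mset_set {1..m ^ length es})"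
    by (simp add: conjugate_def Max c_def[abs_def])
  have 0: "0 \<notin># conjugate lam"
    unfolding conj using c by (auto simp: image_iff)
  have "c 1 \<in># conjugate lam"
    unfolding conj using assms by (auto simp: Suc_le_eq)
  hence "sum_mset (conjugate lam) > 0"
    using 0 by (metis bot_nat_0.not_eq_extremum sum_mset_0_iff)
  hence "m_ary q (conjugate lam)"
    unfolding m_ary_def is_partition_def using 0 c by (auto simp: conj)
  with 1 show ?thesis
    unfolding conj_ary_def lam_def apply_seq_trivial[OF assms] by simp
qed

end

theory Submission
  imports Defs
begin

text \<open>Reading the exponents $e_0 \ge \dots \ge e_K$ as a staircase, summation by parts turns the
  definition of $\chi(A)$ into $q^{e_0} + \sum_{i=1}^{K} q^{e_i} (m^i - m^{i-1})$. In this form a raise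
  just multiplies by $q$ (it lifts every $e_i$), and a migration adds $m^{K+1} - m^K$ (it appends
  $e_{K+1} = 0$); the migration steps of one block telescope. With $S_i = s_1 + \dots + s_i$ and
  $T_i = t_i + \dots + t_k$ this gives (\<open>chi_op_seq\<close>)
  $$\chi = q^{T_1} + \sum_{i=1}^{k} q^{T_{i+1}} (m^{S_i} - m^{S_{i-1}}).$$
  For any $c \le k$ one may sum by parts over the blocks $i \le c$ only, which trades differences of
  powers of $m$ for differences of powers of $q$ (\<open>chi_op_seq_split\<close>). Both formulas of the theorem are
  the choice $c = b$; for $k = 2b+1$ the block $b+1$ is written out separately.

  In expanded form, the positive monomials are the $k+1$ outer corners $(S_i, T_{i+1})$ of a
  staircase and the negative ones its $k$ inner corners $(S_{i-1}, T_{i+1})$. If all $s_i$ and $t_i$ are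
  positive, then every step is proper in both directions, and all these points are distinct
  (\<open>lookup_chi_op_seq_eq_1\<close>, \<open>lookup_chi_op_seq_eq_minus_1\<close>).

  A simple partition other than $(1)_m$ forces all exponents to be positive: if the
  operator applied last is a raise, then the result is a raise (\<open>not_simple_Raise\<close>); if the operator
  applied first is a migration, from $(1)_m$ to $(1,0)_m$, then $a_0 = 0$ for good, and the result is
  a shift (\<open>not_simple_Migrate_first\<close>).\<close>

section \<open>The characteristic polynomial under raise and migration\<close>

lemma length_exps_rec: "length (exps_rec A) = Suc (count_list A Migrate)"
  by (induction A) (auto split: operator.splits)

lemma chi_eq:
  "chi A = var_q ^ (rev (exps_rec A) ! count_list A Migrate) * var_m ^ count_list A Migrate
     + (\<Sum>i<count_list A Migrate.
          (var_q ^ (rev (exps_rec A) ! i) - var_q ^ (rev (exps_rec A) ! Suc i)) * var_m ^ i)"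
  unfolding chi_def exponents_eq by (simp add: Let_def length_exps_rec)

lemma chi_Nil: "chi [] = 1"
  unfolding chi_eq by simp

lemma chi_Raise: "chi (Raise # A) = var_q * chi A"
proof -
  have e: "rev (exps_rec (Raise # A)) ! i = Suc (rev (exps_rec A) ! i)"
    if "i \<le> count_list A Migrate" for i
    using that by (simp add: rev_map length_exps_rec)
  show ?thesis
    unfolding chi_eq by (simp add: e sum_distrib_left algebra_simps del: exps_rec.simps)
qed

lemma chi_Migrate:
  "chi (Migrate # A)
     = chi A + var_m ^ Suc (count_list A Migrate) - var_m ^ count_list A Migrate"
proof -
  define K where "K = count_list A Migrate"
  have K': "count_list (Migrate # A) Migrate = Suc K"
    by (simp add: K_def)
  have len: "length (exps_rec A) = Suc K"
    by (simp add: length_exps_rec K_def)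
  have old: "rev (exps_rec (Migrate # A)) ! i = rev (exps_rec A) ! i" if "i \<le> K" for i
    using that len by (simp add: nth_append)
  have new: "rev (exps_rec (Migrate # A)) ! Suc K = 0"
    using len by (simp add: nth_append)
  show ?thesis
    unfolding chi_eq K' K_def[symmetric]
    by (simp add: old new algebra_simps del: exps_rec.simps)
qed

lemma chi_replicate_Raise: "chi (replicate n Raise @ A) = var_q ^ n * chi A"
  by (induction n) (simp_all add: chi_Nil chi_Raise mult.assoc)

lemma count_list_replicate:
  "count_list (replicate n x) y = (if x = y then n else 0)"
  by (induction n) auto

lemma chi_replicate_Migrate:
  "chi (replicate n Migrate @ A)
     = chi A + var_m ^ (count_list A Migrate + n) - var_m ^ count_list A Migrate"
  by (induction n) (simp_all add: chi_Migrate count_list_replicate add.commute)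

section \<open>The characteristic polynomial of a block sequence\<close>

lemma count_Migrate_op_seq: "count_list (op_seq s t k) Migrate = (\<Sum>j = 1..k. s j)"
  by (induction k) (simp_all add: count_list_replicate)

lemma chi_op_seq:
  "chi (op_seq s t k) = var_q ^ (\<Sum>j = 1..k. t j)
     + (\<Sum>i = 1..k. var_q ^ (\<Sum>j = i + 1..k. t j)
          * (var_m ^ (\<Sum>j = 1..i. s j) - var_m ^ (\<Sum>j = 1..i - 1. s j)))"
proof (induction k)
  case 0
  show ?case by (simp add: chi_Nil)
next
  case (Suc k)
  have pow: "var_q ^ (\<Sum>j = Suc i..Suc k. t j)
      = var_q ^ t (Suc k) * var_q ^ (\<Sum>j = Suc i..k. t j)" if "i \<le> k" for i
    using that by (simp add: power_add mult.commute)
  have "chi (op_seq s t (Suc k)) = var_q ^ t (Suc k) * chi (op_seq s t k)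
      + var_m ^ (\<Sum>j = 1..Suc k. s j) - var_m ^ (\<Sum>j = 1..k. s j)"
    by (simp add: chi_replicate_Migrate chi_replicate_Raise count_list_replicate
        count_Migrate_op_seq)
  then show ?case
    unfolding Suc
    by (simp add: pow[of 0, simplified] pow sum_distrib_left algebra_simps power_add del: sum.cl_ivl_Suc)
       (simp add: algebra_simps power_add)
qed

lemma summation_by_parts:
  fixes x y :: "nat \<Rightarrow> 'a :: comm_ring_1"
  shows "y 1 * x 0 + (\<Sum>i = 1..c. y (i + 1) * (x i - x (i - 1)))
     = (\<Sum>i = 1..c. x (i - 1) * (y i - y (i + 1))) + x c * y (c + 1)"
  by (induction c) (simp_all add: algebra_simps)

lemma sum_split_reversed:
  fixes f :: "nat \<Rightarrow> 'a :: comm_monoid_add"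
  assumes "c \<le> k"
  shows "(\<Sum>i = 1..k. f i) = (\<Sum>i = 1..c. f i) + (\<Sum>i = 1..k - c. f (k + 1 - i))"
proof -
  have "(\<Sum>i = 1..k - c. f (k + 1 - i)) = (\<Sum>i = c + 1..k. f i)"
    by (rule sum.reindex_bij_witness[of _ "\<lambda>i. k + 1 - i" "\<lambda>i. k + 1 - i"]) (use assms in auto)
  then show ?thesis
    using sum.ub_add_nat[of 1 c f "k - c"] assms by simp
qed

text \<open>The blocks above \<open>c\<close> keep their differences of powers of \<open>var_m\<close>, and those up to \<open>c\<close> are
  summed by parts.\<close>

lemma chi_op_seq_split:
  assumes "c \<le> k"
  shows "chi (op_seq s t k) =
      (\<Sum>i = 1..k - c. var_m ^ (\<Sum>j = 1..k - i. s j) * var_q ^ (\<Sum>j = k + 2 - i..k. t j)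
          * (var_m ^ s (k + 1 - i) - 1))
      + var_m ^ (\<Sum>j = 1..c. s j) * var_q ^ (\<Sum>j = c + 1..k. t j)
      + (\<Sum>i = 1..c. var_m ^ (\<Sum>j = 1..i - 1. s j) * var_q ^ (\<Sum>j = i + 1..k. t j)
          * (var_q ^ t i - 1))"
proof -
  define x where "x i = var_m ^ (\<Sum>j = 1..i. s j)" for i
  define y where "y i = var_q ^ (\<Sum>j = i..k. t j)" for i
  have x: "x i - x (i - 1) = x (i - 1) * (var_m ^ s i - 1)" if "1 \<le> i" for i
  proof (cases i)
    case (Suc n)
    then show ?thesis by (simp add: x_def power_add algebra_simps)
  qed (use that in simp)
  have y: "y i - y (i + 1) = y (i + 1) * (var_q ^ t i - 1)" if "i \<le> k" for i
    using that by (simp add: y_def sum.atLeast_Suc_atMost power_add algebra_simps)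
  have upper: "y (k + 1 - i + 1) * (x (k + 1 - i) - x (k + 1 - i - 1))
      = x (k - i) * y (k + 2 - i) * (var_m ^ s (k + 1 - i) - 1)" if "i \<in> {1..k - c}" for i
  proof -
    have "k + 1 - i + 1 = k + 2 - i" "k + 1 - i - 1 = k - i" "1 \<le> k + 1 - i"
      using that by auto
    with x[of "k + 1 - i"] show ?thesis by (simp add: mult_ac)
  qed
  have lower: "x (i - 1) * (y i - y (i + 1)) = x (i - 1) * y (i + 1) * (var_q ^ t i - 1)"
    if "i \<in> {1..c}" for i
    using that assms by (simp add: y mult.assoc del: One_nat_def)
  have upper_sum: "(\<Sum>i = 1..k - c. y (k + 1 - i + 1) * (x (k + 1 - i) - x (k + 1 - i - 1)))
      = (\<Sum>i = 1..k - c. x (k - i) * y (k + 2 - i) * (var_m ^ s (k + 1 - i) - 1))"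
    by (rule sum.cong[OF refl upper])
  have lower_sum: "(\<Sum>i = 1..c. x (i - 1) * (y i - y (i + 1)))
      = (\<Sum>i = 1..c. x (i - 1) * y (i + 1) * (var_q ^ t i - 1))"
    by (rule sum.cong[OF refl lower])
  have "chi (op_seq s t k) = y 1 * x 0 + (\<Sum>i = 1..k. y (i + 1) * (x i - x (i - 1)))"
    unfolding chi_op_seq by (simp add: x_def y_def)
  also have "\<dots> = (\<Sum>i = 1..k - c. y (k + 1 - i + 1) * (x (k + 1 - i) - x (k + 1 - i - 1)))
      + (y 1 * x 0 + (\<Sum>i = 1..c. y (i + 1) * (x i - x (i - 1))))"
    unfolding sum_split_reversed[OF assms] by (simp add: add_ac)
  also have "\<dots> = (\<Sum>i = 1..k - c. x (k - i) * y (k + 2 - i) * (var_m ^ s (k + 1 - i) - 1))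
      + x c * y (c + 1) + (\<Sum>i = 1..c. x (i - 1) * y (i + 1) * (var_q ^ t i - 1))"
    unfolding summation_by_parts upper_sum lower_sum
    by (simp only: add_ac)
  finally show ?thesis
    by (simp add: x_def y_def)
qed

section \<open>The monomials\<close>

lemma var_m_power: "var_m ^ n = Poly_Mapping.single (n, 0) 1"
  by (induction n) (simp_all add: var_m_def mult_single zero_prod_def[symmetric])

lemma var_q_power: "var_q ^ n = Poly_Mapping.single (0, n) 1"
  by (induction n) (simp_all add: var_q_def mult_single zero_prod_def[symmetric])

lemma monomial_eq_single: "var_q ^ b * var_m ^ a = Poly_Mapping.single (a, b) 1"
  by (simp add: var_m_power var_q_power mult_single)

definition outer_corner :: "(nat \<Rightarrow> nat) \<Rightarrow> (nat \<Rightarrow> nat) \<Rightarrow> nat \<Rightarrow> nat \<Rightarrow> nat \<times> nat" where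
  "outer_corner s t k i = (\<Sum>j = 1..i. s j, \<Sum>j = i + 1..k. t j)"

definition inner_corner :: "(nat \<Rightarrow> nat) \<Rightarrow> (nat \<Rightarrow> nat) \<Rightarrow> nat \<Rightarrow> nat \<Rightarrow> nat \<times> nat" where
  "inner_corner s t k i = (\<Sum>j = 1..i - 1. s j, \<Sum>j = i + 1..k. t j)"

lemma chi_op_seq_corners:
  "chi (op_seq s t k) = (\<Sum>i \<in> {0..k}. Poly_Mapping.single (outer_corner s t k i) 1)
     - (\<Sum>i \<in> {1..k}. Poly_Mapping.single (inner_corner s t k i) 1)"
proof -
  have "(\<Sum>i \<in> {0..k}. Poly_Mapping.single (outer_corner s t k i) (1::int))
      = var_q ^ (\<Sum>j = 1..k. t j)
        + (\<Sum>i = 1..k. Poly_Mapping.single (outer_corner s t k i) 1)"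
    by (simp add: sum.atLeast_Suc_atMost outer_corner_def var_q_power)
  then show ?thesis
    unfolding chi_op_seq
    by (simp add: right_diff_distrib monomial_eq_single sum_subtractf
        outer_corner_def inner_corner_def)
qed

lemma lookup_sum_single:
  fixes f :: "'i \<Rightarrow> 'k"
  assumes "finite I" "inj_on f I"
  shows "Poly_Mapping.lookup (\<Sum>i\<in>I. Poly_Mapping.single (f i) (1::int)) x
    = (if x \<in> f ` I then 1 else 0)"
proof -
  have "Poly_Mapping.lookup (\<Sum>i\<in>I. Poly_Mapping.single (f i) (1::int)) x
      = (\<Sum>i\<in>I. if f i = x then 1 else 0)"
    by (auto simp: lookup_sum lookup_single when_def intro!: sum.cong)
  also have "\<dots> = (\<Sum>z\<in>f ` I. if z = x then 1 else 0)"
    by (simp only: sum.reindex[OF assms(2)] o_def)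
  also have "\<dots> = (if x \<in> f ` I then 1 else 0)"
    using assms(1) by simp
  finally show ?thesis .
qed

context
  fixes s t :: "nat \<Rightarrow> nat" and k :: nat
  assumes pos: "\<And>i. 1 \<le> i \<Longrightarrow> i \<le> k \<Longrightarrow> s i > 0 \<and> t i > 0"
begin

lemma partial_sums_inj: "inj_on (\<lambda>i. \<Sum>j = 1..i. s j) {0..k}"
proof -
  have less: "(\<Sum>j = 1..i. s j) < (\<Sum>j = 1..i'. s j)" if "i < i'" "i' \<le> k" for i i'
  proof -
    have "s i' > 0"
      using that pos[of i'] by simp
    with that show ?thesis
      by (intro sum_strict_mono2[where b = i']) auto
  qed
  show ?thesis
  proof (rule inj_onI)
    fix i i' assume "i \<in> {0..k}" "i' \<in> {0..k}" "(\<Sum>j = 1..i. s j) = (\<Sum>j = 1..i'. s j)"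
    with less[of i i'] less[of i' i] show "i = i'"
      by (cases i i' rule: linorder_cases) simp_all
  qed
qed

lemma inj_on_outer_corner: "inj_on (outer_corner s t k) {0..k}"
proof (rule inj_onI)
  fix i j assume "i \<in> {0..k}" "j \<in> {0..k}" "outer_corner s t k i = outer_corner s t k j"
  then show "i = j"
    unfolding outer_corner_def prod.inject by (elim conjE) (rule inj_onD[OF partial_sums_inj])
qed

lemma inj_on_inner_corner: "inj_on (inner_corner s t k) {1..k}"
proof (rule inj_onI)
  fix i j assume ij: "i \<in> {1..k}" "j \<in> {1..k}" "inner_corner s t k i = inner_corner s t k j"
  have "i - 1 = j - 1"
    by (rule inj_onD[OF partial_sums_inj]) (use ij in \<open>auto simp: inner_corner_def\<close>)
  with ij show "i = j" by auto
qed

text \<open>An inner corner lies in the column of only one outer corner, namely the preceding one, and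
  strictly below it because \<open>t\<close> is positive.\<close>

lemma corners_disjoint: "outer_corner s t k ` {0..k} \<inter> inner_corner s t k ` {1..k} = {}"
proof -
  have False if i: "i \<in> {0..k}" "j \<in> {1..k}" and eq: "outer_corner s t k i = inner_corner s t k j"
    for i j
  proof -
    have "i = j - 1"
      by (rule inj_onD[OF partial_sums_inj])
         (use i eq in \<open>auto simp: outer_corner_def inner_corner_def\<close>)
    then have "i + 1 = j"
      using i by auto
    then have "(\<Sum>l = j..k. t l) = (\<Sum>l = j + 1..k. t l)"
      using eq by (simp add: outer_corner_def inner_corner_def)
    moreover have "(\<Sum>l = j..k. t l) = t j + (\<Sum>l = j + 1..k. t l)"
      using i by (simp add: sum.atLeast_Suc_atMost)
    ultimately show False
      using pos[of j] i by simp
  qed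
  then show ?thesis by blast
qed

lemma lookup_chi_op_seq:
  "Poly_Mapping.lookup (chi (op_seq s t k)) x
     = (if x \<in> outer_corner s t k ` {0..k} then 1 else 0)
       - (if x \<in> inner_corner s t k ` {1..k} then 1 else 0)"
  unfolding chi_op_seq_corners lookup_minus
  by (simp only: lookup_sum_single[OF _ inj_on_outer_corner]
      lookup_sum_single[OF _ inj_on_inner_corner] finite_atLeastAtMost)

lemma lookup_chi_op_seq_eq_1:
  "{x. Poly_Mapping.lookup (chi (op_seq s t k)) x = 1} = outer_corner s t k ` {0..k}"
  unfolding lookup_chi_op_seq using corners_disjoint by (auto split: if_splits)

lemma lookup_chi_op_seq_eq_minus_1:
  "{x. Poly_Mapping.lookup (chi (op_seq s t k)) x = -1} = inner_corner s t k ` {1..k}"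
  unfolding lookup_chi_op_seq using corners_disjoint by (auto split: if_splits)

lemma card_monomials_chi_op_seq:
  "card {x. Poly_Mapping.lookup (chi (op_seq s t k)) x = 1} = k + 1"
  "card {x. Poly_Mapping.lookup (chi (op_seq s t k)) x = -1} = k"
  unfolding lookup_chi_op_seq_eq_1 lookup_chi_op_seq_eq_minus_1
  by (simp_all add: card_image inj_on_outer_corner inj_on_inner_corner del: One_nat_def)

end

section \<open>Sequences that do not generate a simple partition\<close>

lemma mults_apply_seq:
  assumes "m \<ge> 2" "q \<ge> 2"
  shows "mults m (apply_seq m q A trivial_part) = diffs q 0 (exps_rec A)"
proof -
  obtain e es where e: "exps_rec A = e # es"
    using exps_rec_nonempty by (metis list.exhaust)
  show ?thesis
    unfolding apply_seq_trivial[OF assms] e using assms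
    by (simp add: mults_of_mults del: of_mults.simps)
qed

lemma not_simple_Raise:
  assumes "m \<ge> 2" "q \<ge> 2"
  shows "\<not> simple_part m q (apply_seq m q (Raise # A) trivial_part)"
proof -
  define mu where "mu = apply_seq m q A trivial_part"
  define lam where "lam = apply_seq m q (Raise # A) trivial_part"
  have "lam = raise_part m q mu"
    by (simp add: lam_def mu_def apply_seq_def)
  moreover have "mu \<noteq> lam"
  proof -
    obtain e es where e: "exps_rec A = e # es"
      using exps_rec_nonempty by (metis list.exhaust)
    \<comment> \<open>the two partitions have leading multiplicities $q^e$ and $q^{e+1}$\<close>
    have "mults m mu \<noteq> mults m lam"
      unfolding mu_def lam_def mults_apply_seq[OF assms] using assms by (simp add: e)
    then show ?thesis by blast
  qed
  moreover have "conj_ary m q mu"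
    unfolding mu_def by (rule conj_ary_apply_seq[OF assms])
  ultimately show ?thesis
    unfolding simple_part_def lam_def[symmetric] by blast
qed

lemma exps_rec_append_Migrate: "exps_rec (A @ [Migrate]) = exps_rec A @ [last (exps_rec A)]"
  by (induction A) (auto split: operator.splits simp: exps_rec_nonempty last_map)

lemma diffs_append_last: "es \<noteq> [] \<Longrightarrow> diffs q p (es @ [last es]) = diffs q p es @ [0]"
  by (induction es arbitrary: p) auto

text \<open>All later operators treat the last two exponents, which start out equal, alike; so the
  multiplicity $a_0$ stays \<open>0\<close>.\<close>

lemma not_simple_Migrate_first:
  assumes "m \<ge> 2" "q \<ge> 2"
  shows "\<not> simple_part m q (apply_seq m q (A @ [Migrate]) trivial_part)"
proof -
  define mu where "mu = apply_seq m q A trivial_part"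
  define lam where "lam = apply_seq m q (A @ [Migrate]) trivial_part"
  have d: "diffs q 0 (exps_rec (A @ [Migrate])) = diffs q 0 (exps_rec A) @ [0]"
    by (simp add: exps_rec_append_Migrate diffs_append_last exps_rec_nonempty)
  have "lam = shift_part m mu"
    unfolding shift_part_def mu_def mults_apply_seq[OF assms]
    unfolding lam_def apply_seq_trivial[OF assms] d ..
  moreover have "mu \<noteq> lam"
  proof -
    have "mults m mu \<noteq> mults m lam"
      unfolding mu_def lam_def mults_apply_seq[OF assms] by (simp add: d)
    then show ?thesis by blast
  qed
  moreover have "conj_ary m q mu"
    unfolding mu_def by (rule conj_ary_apply_seq[OF assms])
  ultimately show ?thesis
    unfolding simple_part_def lam_def[symmetric] by blast
qed

lemma op_seq_first_block:
  assumes "k \<ge> 1"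
  shows "\<exists>B. op_seq s t k = B @ replicate (s 1) Migrate @ replicate (t 1) Raise"
  using assms
proof (induction k rule: dec_induct)
  case base
  show ?case by simp
next
  case (step n)
  then obtain B where "op_seq s t n = B @ replicate (s 1) Migrate @ replicate (t 1) Raise"
    by blast
  then have "op_seq s t (Suc n)
      = (replicate (s (Suc n)) Migrate @ replicate (t (Suc n)) Raise @ B)
        @ replicate (s 1) Migrate @ replicate (t 1) Raise"
    by simp
  then show ?case by blast
qed

text \<open>Only the two exponents that may vanish, \<open>s k\<close> and \<open>t 1\<close>, are at stake. For \<open>k = 1\<close> both may
  vanish at once, but then the partition is trivial.\<close>

lemma simple_imp_exponents_pos:
  assumes mq: "m \<ge> 2" "q \<ge> 2"
    and s: "\<And>i. 1 \<le> i \<Longrightarrow> i < k \<Longrightarrow> s i > 0"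
    and t: "\<And>i. 1 < i \<Longrightarrow> i \<le> k \<Longrightarrow> t i > 0"
    and simple: "simple_part m q (apply_seq m q (op_seq s t k) trivial_part)"
    and nontrivial: "apply_seq m q (op_seq s t k) trivial_part \<noteq> trivial_part"
    and i: "1 \<le> i" "i \<le> k"
  shows "s i > 0 \<and> t i > 0"
proof -
  have not_Raise: "op_seq s t k \<noteq> Raise # A" for A
    using not_simple_Raise[OF mq] simple by metis
  have not_Migrate: "op_seq s t k \<noteq> A @ [Migrate]" for A
    using not_simple_Migrate_first[OF mq] simple by metis
  obtain l where k: "k = Suc l"
    using i by (cases k) auto
  have "s k > 0"
  proof (rule ccontr)
    assume "\<not> s k > 0"
    then have seq: "op_seq s t k = replicate (t k) Raise @ op_seq s t l"
      by (simp add: k)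
    show False
    proof (cases "t k")
      case 0
      with t[of k] k have "l = 0" by (cases l) auto
      with seq 0 nontrivial show False by (simp add: apply_seq_def)
    next
      case (Suc n)
      with seq not_Raise show False by simp
    qed
  qed
  with s have s_pos: "s j > 0" if "1 \<le> j" "j \<le> k" for j
    using that by (cases "j = k") auto
  have "t 1 > 0"
  proof (rule ccontr)
    assume "\<not> t 1 > 0"
    moreover obtain B where "op_seq s t k = B @ replicate (s 1) Migrate @ replicate (t 1) Raise"
      using op_seq_first_block[of k s t] k by auto
    ultimately have B: "op_seq s t k = B @ replicate (s 1) Migrate"
      by simp
    obtain n where "s 1 = Suc n"
      using s_pos[of 1] k by (cases "s 1") auto
    then have "op_seq s t k = (B @ replicate n Migrate) @ [Migrate]"
      unfolding B by (simp add: replicate_append_same)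
    with not_Migrate show False by blast
  qed
  with t have "t i > 0"
    using i by (cases "i = 1") auto
  with s_pos i show ?thesis by blast
qed

section \<open>The characteristic polynomial of a generated partition\<close>

theorem theorem3p7:
  fixes m q k :: nat and s t :: "nat \<Rightarrow> nat" and lam :: "nat multiset"
  assumes "m \<ge> 2" and "q \<ge> 2"
    and "conj_ary m q lam"
    and "lam = apply_seq m q (op_seq s t k) trivial_part"
    and "\<forall>i. 1 \<le> i \<and> i < k \<longrightarrow> s i > 0"
    and "\<forall>i. 1 < i \<and> i \<le> k \<longrightarrow> t i > 0"
  shows
    "(\<forall>b. k = 2 * b + 1 \<longrightarrow>
        chi (op_seq s t (2 * b + 1)) =
          (\<Sum>i = 1..b. var_m ^ (\<Sum>j = 1..2 * b + 1 - i. s j)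
                       * var_q ^ (\<Sum>j = 2 * b + 3 - i..2 * b + 1. t j)
                       * (var_m ^ s (2 * b + 2 - i) - 1))
          + var_m ^ (\<Sum>j = 1..b + 1. s j) * var_q ^ (\<Sum>j = b + 2..2 * b + 1. t j)
          - var_m ^ (\<Sum>j = 1..b. s j) * var_q ^ (\<Sum>j = b + 2..2 * b + 1. t j)
          + var_m ^ (\<Sum>j = 1..b. s j) * var_q ^ (\<Sum>j = b + 1..2 * b + 1. t j)
          + (\<Sum>i = 1..b. var_m ^ (\<Sum>j = 1..i - 1. s j)
                         * var_q ^ (\<Sum>j = i + 1..2 * b + 1. t j)
                         * (var_q ^ t i - 1)))
     \<and> (\<forall>b. k = 2 * b \<longrightarrow>
        chi (op_seq s t (2 * b)) =
          (\<Sum>i = 1..b. var_m ^ (\<Sum>j = 1..2 * b - i. s j)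
                       * var_q ^ (\<Sum>j = 2 * b + 2 - i..2 * b. t j)
                       * (var_m ^ s (2 * b + 1 - i) - 1))
          + var_m ^ (\<Sum>j = 1..b. s j) * var_q ^ (\<Sum>j = b + 1..2 * b. t j)
          + (\<Sum>i = 1..b. var_m ^ (\<Sum>j = 1..i - 1. s j)
                         * var_q ^ (\<Sum>j = i + 1..2 * b. t j)
                         * (var_q ^ t i - 1)))
     \<and> (simple_part m q lam \<and> lam \<noteq> trivial_part \<longrightarrow>
          (\<forall>i. 1 \<le> i \<and> i \<le> k \<longrightarrow> s i > 0 \<and> t i > 0))
     \<and> (simple_part m q lam \<and> (\<forall>i. 1 \<le> i \<and> i \<le> k \<longrightarrow> s i > 0 \<and> t i > 0) \<longrightarrow>
          card {x. Poly_Mapping.lookup (chi (op_seq s t k)) x = 1} = k + 1 \<and>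
          card {x. Poly_Mapping.lookup (chi (op_seq s t k)) x = -1} = k)"
proof (intro conjI allI impI)
  fix b :: nat
  have bs: "2 * b + 1 - (b + 1) = b" "2 * b + 2 - (b + 1) = b + 1" "2 * b + 3 - (b + 1) = b + 2"
    by simp_all
  \<comment> \<open>the last summand of the upper sum, for block \<open>b + 1\<close>, is expanded\<close>
  have mid: "var_m ^ (\<Sum>j = 1..b. s j) * var_q ^ n * (var_m ^ s (b + 1) - 1)
      = var_m ^ (\<Sum>j = 1..b + 1. s j) * var_q ^ n - var_m ^ (\<Sum>j = 1..b. s j) * var_q ^ n" for n
    by (simp add: power_add algebra_simps)
  have last: "(\<Sum>i = 1..b + 1. f i) = (\<Sum>i = 1..b. f i) + f (b + 1)" for f :: "nat \<Rightarrow> zpoly2"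
    by simp
  have eqs: "2 * b + 1 - b = b + 1" "2 * b + 1 + 2 = 2 * b + 3" "2 * b + 1 + 1 = 2 * b + 2"
    by simp_all
  show "chi (op_seq s t (2 * b + 1)) =
          (\<Sum>i = 1..b. var_m ^ (\<Sum>j = 1..2 * b + 1 - i. s j)
                       * var_q ^ (\<Sum>j = 2 * b + 3 - i..2 * b + 1. t j)
                       * (var_m ^ s (2 * b + 2 - i) - 1))
          + var_m ^ (\<Sum>j = 1..b + 1. s j) * var_q ^ (\<Sum>j = b + 2..2 * b + 1. t j)
          - var_m ^ (\<Sum>j = 1..b. s j) * var_q ^ (\<Sum>j = b + 2..2 * b + 1. t j)
          + var_m ^ (\<Sum>j = 1..b. s j) * var_q ^ (\<Sum>j = b + 1..2 * b + 1. t j)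
          + (\<Sum>i = 1..b. var_m ^ (\<Sum>j = 1..i - 1. s j)
                         * var_q ^ (\<Sum>j = i + 1..2 * b + 1. t j)
                         * (var_q ^ t i - 1))"
    using chi_op_seq_split[of b "2 * b + 1" s t]
    unfolding eqs last bs mid by (simp only: add_diff_eq)
next
  fix b :: nat
  show "chi (op_seq s t (2 * b)) =
          (\<Sum>i = 1..b. var_m ^ (\<Sum>j = 1..2 * b - i. s j)
                       * var_q ^ (\<Sum>j = 2 * b + 2 - i..2 * b. t j)
                       * (var_m ^ s (2 * b + 1 - i) - 1))
          + var_m ^ (\<Sum>j = 1..b. s j) * var_q ^ (\<Sum>j = b + 1..2 * b. t j)
          + (\<Sum>i = 1..b. var_m ^ (\<Sum>j = 1..i - 1. s j)
                         * var_q ^ (\<Sum>j = i + 1..2 * b. t j)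
                         * (var_q ^ t i - 1))"
    using chi_op_seq_split[of b "2 * b" s t] by simp
next
  fix i
  assume "simple_part m q lam \<and> lam \<noteq> trivial_part" "1 \<le> i \<and> i \<le> k"
  with assms have "s i > 0 \<and> t i > 0"
    by (intro simple_imp_exponents_pos[of m q k s t i]) auto
  then show "s i > 0" "t i > 0"
    by simp_all
next
  assume "simple_part m q lam \<and> (\<forall>i. 1 \<le> i \<and> i \<le> k \<longrightarrow> s i > 0 \<and> t i > 0)"
  then have "\<And>i. 1 \<le> i \<Longrightarrow> i \<le> k \<Longrightarrow> s i > 0 \<and> t i > 0"
    by blast
  from card_monomials_chi_op_seq[of k s t, OF this]
  show "card {x. Poly_Mapping.lookup (chi (op_seq s t k)) x = 1} = k + 1"
    and "card {x. Poly_Mapping.lookup (chi (op_seq s t k)) x = -1} = k"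
    by simp_all
qed

end
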